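(* For all real $p,q>1$ and all $x\in(0,1)$, the following hold. (1) $$x\left(1+\frac{x^q}{p(1+q)}\right)<\operatorname{arcsin}_{p,q}x<\min\left\{\frac{\pi_{p,q}}{2}\,x,\ (1-x^q)^{-1/(p(1+q))}\,x\right\}.$$ (2) $$\left(\frac{x^p}{1+x^q}\right)^{1/p}L(p,q,x)<\operatorname{arsinh}_{p,q}x<\left(\frac{x^p}{1+x^q}\right)^{1/p}U(p,q,x),$$ where $$L(p,q,x)=\max\left\{\left(1-\frac{q\,x^q}{p(1+q)(1+x^q)}\right)^{-1},\ (x^q+1)^{1/p}\left(\frac{pq+p+q\,x^q}{p(q+1)}\right)^{-1/q}\right\}$$ and $$U(p,q,x)=\left(1-\frac{x^q}{1+x^q}\right)^{-q/(p(q+1))}.$$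
   Context: For real $p,q>1$ and $x\in[0,1]$ define $$\operatorname{arcsin}_{p,q}x=\int_0^x(1-t^q)^{-1/p}\,dt,\qquad \operatorname{arsinh}_{p,q}x=\int_0^x(1+t^q)^{-1/p}\,dt .$$ The constant $\pi_{p,q}$ is $$\pi_{p,q}=2\int_0^1(1-t^q)^{-1/p}\,dt=\frac{2}{q}B\left(1-\frac1p,\frac1q\right),$$ where $B(a,b)=\Gamma(a)\Gamma(b)/\Gamma(a+b)$ is the beta function; thus $\operatorname{arcsin}_{p,q}1=\pi_{p,q}/2$. *)

theory Defs
  imports "HOL-Analysis.Analysis"
begin

definition arcsin_pq :: "real \<Rightarrow> real \<Rightarrow> real \<Rightarrow> real" where
  "arcsin_pq p q x = integral {0..x} (\<lambda>t. (1 - t powr q) powr (- 1 / p))"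

definition arsinh_pq :: "real \<Rightarrow> real \<Rightarrow> real \<Rightarrow> real" where
  "arsinh_pq p q x = integral {0..x} (\<lambda>t. (1 + t powr q) powr (- 1 / p))"

(* The integrand is singular at 1, where powr gives it the value 0. A single point does not
   affect the gauge integral, and the gauge integral includes improper integrals. *)
definition pi_pq :: "real \<Rightarrow> real \<Rightarrow> real" where
  "pi_pq p q = 2 * integral {0..1} (\<lambda>t. (1 - t powr q) powr (- 1 / p))"

definition L_pq :: "real \<Rightarrow> real \<Rightarrow> real \<Rightarrow> real" where
  "L_pq p q x =
     max (inverse (1 - (q * x powr q) / (p * (1 + q) * (1 + x powr q))))
         ((x powr q + 1) powr (1 / p) *
          ((p * q + p + q * x powr q) / (p * (q + 1))) powr (- 1 / q))"

definition U_pq :: "real \<Rightarrow> real \<Rightarrow> real \<Rightarrow> real" where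
  "U_pq p q x = (1 - x powr q / (1 + x powr q)) powr (- q / (p * (q + 1)))"

end

theory Submission
  imports Defs
begin

text \<open>
  Write \<open>a = 1/p\<close> and \<open>s = t\<^sup>q\<close>. Except for the bound by \<open>\<pi>\<^bsub>p,q\<^esub>\<close>, each bound \<open>G\<close> is
  an elementary function that vanishes at 0, so it is enough to compare \<open>G'\<close> with the integrand
  \<open>(1 \<plusminus> s)\<^bsup>-a\<^esup>\<close> (\<open>integral_less_by_deriv\<close>, \<open>integral_greater_by_deriv\<close>). With
  \<open>c = aq / (1 + q)\<close>, which lies in \<open>(0, 1)\<close>, the comparisons come down to Bernoulli's inequality
  \<open>(1 + y)\<^bsup>k\<^esup> < 1 + ky\<close> for \<open>0 < k < 1\<close> or to algebra.

  Once the powers of \<open>1 + s\<close> are collected, the upper bound for arsinh and the second one for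
  arcsin are the same statement: both bounds are \<open>x (1 + y)\<^bsup>-a/(1+q)\<^esup>\<close> with \<open>y = \<plusminus>s\<close>, whose
  derivative exceeds the integrand precisely when \<open>(1 + y)\<^bsup>1-c\<^esup> < 1 + (1 - c) y\<close>. The lower bound for arcsin is Bernoulli with
  the exponent \<open>-a\<close>. The second lower bound for arsinh is \<open>x (1 + cs)\<^bsup>-1/q\<^esup>\<close>, with derivative
  \<open>(1 + cs)\<^bsup>-1/q-1\<^esup>\<close>; since \<open>c (1/q + 1) = a\<close>, this is less than \<open>(1 + s)\<^bsup>-a\<^esup>\<close> by Bernoulli
  with exponent \<open>c\<close>. For the first lower bound \<open>x (1 + s)\<^bsup>1-a\<^esup> / (1 + (1 - c) s)\<close> the choice of
  \<open>c\<close> cancels the terms of order \<open>s\<close> in the comparison, and what is left is a negative multiple of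
  \<open>s\<^sup>2\<close>.

  Finally, the integrand of arcsin is strictly increasing, so its mean over \<open>[0, x]\<close> is less than
  its mean over \<open>[0, 1]\<close>; the latter is \<open>\<pi>\<^bsub>p,q\<^esub> / 2\<close>.
\<close>

section \<open>Bernoulli inequalities for real exponents\<close>

text \<open>
  This is the strict concavity of the logarithm: \<open>w = 1 + ky\<close> is the mean of \<open>1 + y\<close> and \<open>1\<close> with
  weights \<open>k\<close> and \<open>1 - k\<close>, and the graph of the logarithm lies below its tangent at \<open>w\<close>.
\<close>

lemma Bernoulli_powr_less:
  fixes k y :: real
  assumes k: "0 < k" "k < 1" and y: "-1 < y" "y \<noteq> 0"
  shows "(1 + y) powr k < 1 + k * y"
proof -
  define w where "w = 1 + k * y"
  have "k * (1 + y) > 0"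
    using k y by simp
  then have w: "w > 0"
    using k by (simp add: w_def algebra_simps)
  have tangent: "ln u < ln w + (u - w) / w" if "u > 0" "u \<noteq> w" for u
  proof -
    have "ln (u / w) \<le> u / w - 1" "ln (u / w) \<noteq> u / w - 1"
      using that w ln_le_minus_one[of "u / w"] ln_eq_minus_one[of "u / w"] by auto
    moreover have "u / w - 1 = (u - w) / w" "ln (u / w) = ln u - ln w"
      using w that by (simp_all add: field_simps ln_div)
    ultimately show ?thesis
      by simp
  qed
  have ne: "1 \<noteq> w" "1 + y \<noteq> w"
    using k y by (auto simp: w_def)
  have "k * ln (1 + y) < k * (ln w + (1 + y - w) / w)"
    using tangent[of "1 + y"] ne y k by (intro mult_strict_left_mono) auto
  moreover have "(1 - k) * ln 1 < (1 - k) * (ln w + (1 - w) / w)"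
    using tangent[of 1] ne k by (intro mult_strict_left_mono) auto
  moreover have "k * (ln w + (1 + y - w) / w) + (1 - k) * (ln w + (1 - w) / w) = ln w"
    using w by (simp add: field_simps) (simp add: w_def algebra_simps)
  ultimately have "k * ln (1 + y) < ln w"
    by simp
  then have "exp (k * ln (1 + y)) < w"
    using w by (metis exp_less_mono exp_ln)
  then show ?thesis
    using w y by (auto simp add: powr_def w_def)
qed

text \<open>
  The reciprocal of the previous inequality, since \<open>(1 - ky) (1 + ky) \<le> 1\<close>.
\<close>

lemma Bernoulli_powr_minus_greater:
  fixes k y :: real
  assumes k: "0 < k" "k < 1" and y: "-1 < y" "y \<noteq> 0"
  shows "1 - k * y < (1 + y) powr (- k)"
proof -
  have pos: "0 < (1 + y) powr k"
    using y by simp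
  have "(1 - k * y) * (1 + y) powr k < 1"
  proof (cases "1 - k * y > 0")
    case True
    then have "(1 - k * y) * (1 + y) powr k < (1 - k * y) * (1 + k * y)"
      using Bernoulli_powr_less[OF k y] by (intro mult_strict_left_mono)
    also have "\<dots> = 1 - (k * y)\<^sup>2"
      by (simp add: power2_eq_square algebra_simps)
    also have "\<dots> \<le> 1"
      by simp
    finally show ?thesis .
  next
    case False
    then have "(1 - k * y) * (1 + y) powr k \<le> 0"
      using pos by (simp add: mult_le_0_iff)
    then show ?thesis
      by simp
  qed
  then show ?thesis
    using pos by (simp add: powr_minus field_simps)
qed

section \<open>Comparing an integral with a function by derivatives\<close>

text \<open>
  Derivatives are compared only in the open interval because the powers of \<open>t\<close> that occur below
  need not be differentiable at 0.
\<close>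

lemma integral_less_by_deriv:
  fixes f G :: "real \<Rightarrow> real"
  assumes x: "0 < x" and f: "continuous_on {0..x} f"
    and G: "continuous_on {0..x} G" "G 0 = 0"
    and D: "\<And>t. 0 < t \<Longrightarrow> t < x \<Longrightarrow> \<exists>d. (G has_real_derivative d) (at t) \<and> f t < d"
  shows "integral {0..x} f < G x"
proof -
  define H where "H = (\<lambda>t. G t - integral {0..t} f)"
  have "H 0 < H x"
  proof (rule DERIV_pos_imp_increasing_open[OF x])
    fix t assume t: "0 < t" "t < x"
    then obtain d where d: "(G has_real_derivative d) (at t)" "f t < d"
      using D by blast
    have "((\<lambda>u. integral {0..u} f) has_real_derivative f t) (at t within {0..x})"
      using t by (intro integral_has_real_derivative f) auto
    then have "((\<lambda>u. integral {0..u} f) has_real_derivative f t) (at t)"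
      using t by (simp add: at_within_Icc_at)
    from DERIV_diff[OF d(1) this] d(2)
    show "\<exists>y. (H has_real_derivative y) (at t) \<and> 0 < y"
      by (auto simp: H_def intro!: exI[of _ "d - f t"])
  next
    show "continuous_on {0..x} H"
      unfolding H_def
      by (intro continuous_intros G indefinite_integral_continuous_1 integrable_continuous_real f)
  qed
  then show ?thesis
    using G(2) by (simp add: H_def)
qed

lemma integral_greater_by_deriv:
  fixes f G :: "real \<Rightarrow> real"
  assumes x: "0 < x" and f: "continuous_on {0..x} f"
    and G: "continuous_on {0..x} G" "G 0 = 0"
    and D: "\<And>t. 0 < t \<Longrightarrow> t < x \<Longrightarrow> \<exists>d. (G has_real_derivative d) (at t) \<and> d < f t"
  shows "G x < integral {0..x} f"
proof -
  have "integral {0..x} (\<lambda>t. - f t) < - G x"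
  proof (rule integral_less_by_deriv[OF x, where G = "\<lambda>t. - G t"])
    fix t assume "0 < t" "t < x"
    then obtain d where "(G has_real_derivative d) (at t)" "d < f t"
      using D by blast
    then show "\<exists>d. ((\<lambda>t. - G t) has_real_derivative d) (at t) \<and> - f t < d"
      by (auto intro!: exI[of _ "- d"] derivative_intros)
  qed (use f G in \<open>auto intro!: continuous_intros\<close>)
  then show ?thesis
    by simp
qed

section \<open>Powers of \<open>1 + \<sigma> t\<^sup>q\<close>\<close>

lemma one_plus_mult_powr_pos:
  fixes \<sigma> q x t :: real
  assumes "0 < q" "0 \<le> t" "t \<le> x" "0 < 1 + \<sigma> * x powr q"
  shows "0 < 1 + \<sigma> * t powr q"
proof (cases "\<sigma> \<ge> 0")
  case True
  then show ?thesis
    by (simp add: add_pos_nonneg)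
next
  case False
  then have "\<sigma> * x powr q \<le> \<sigma> * t powr q"
    using assms by (intro mult_left_mono_neg powr_mono2) auto
  then show ?thesis
    using assms by linarith
qed

lemma continuous_on_one_plus_mult_powr:
  fixes \<sigma> q x e :: real
  assumes "0 < q" "0 < 1 + \<sigma> * x powr q"
  shows "continuous_on {0..x} (\<lambda>t. (1 + \<sigma> * t powr q) powr e)"
proof -
  have "0 < 1 + \<sigma> * t powr q" if "t \<in> {0..x}" for t
    using one_plus_mult_powr_pos[OF assms(1) _ _ assms(2), of t] that by auto
  then show ?thesis
    using assms(1) by (intro continuous_on_powr' continuous_intros) (auto simp: less_imp_le less_imp_neq[symmetric])
qed

text \<open>
  Each bound in terms of \<open>x\<^sup>q\<close> is a function of this shape or, in one case, a quotient with such
  a numerator. The exponent matters through the factor \<open>1 + eq\<close>: it is \<open>1 - c\<close> for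
  \<open>e = -a / (1 + q)\<close>, where \<open>c = aq / (1 + q)\<close>, and vanishes for \<open>e = -1/q\<close>.
\<close>

lemma has_real_derivative_times_powr:
  fixes \<sigma> q e t :: real
  assumes t: "0 < t" and pos: "0 < 1 + \<sigma> * t powr q"
  shows "((\<lambda>t. t * (1 + \<sigma> * t powr q) powr e) has_real_derivative
    (1 + \<sigma> * t powr q) powr (e - 1) * (1 + (1 + e * q) * (\<sigma> * t powr q))) (at t)"
proof -
  have s: "((\<lambda>t. t powr q) has_real_derivative q * t powr (q - 1)) (at t)"
    using t by (rule has_real_derivative_powr)
  have "((\<lambda>t. t * (1 + \<sigma> * t powr q) powr e) has_real_derivative
    1 * (1 + \<sigma> * t powr q) powr e
      + (e * (1 + \<sigma> * t powr q) powr (e - 1) * (\<sigma> * (q * t powr (q - 1)))) * t) (at t)"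
    using pos
    by (intro DERIV_mult DERIV_ident DERIV_chain2[OF has_real_derivative_powr])
       (auto intro!: derivative_eq_intros s t)
  also have "t powr (q - 1) = t powr q / t"
    using t by (simp add: powr_diff)
  also have "(1 + \<sigma> * t powr q) powr e
      = (1 + \<sigma> * t powr q) powr (e - 1) * (1 + \<sigma> * t powr q)"
    using pos by (simp add: powr_diff)
  also have "1 * ((1 + \<sigma> * t powr q) powr (e - 1) * (1 + \<sigma> * t powr q))
      + (e * (1 + \<sigma> * t powr q) powr (e - 1) * (\<sigma> * (q * (t powr q / t)))) * t
    = (1 + \<sigma> * t powr q) powr (e - 1) * (1 + (1 + e * q) * (\<sigma> * t powr q))"
    using t by (simp add: algebra_simps)
  finally show ?thesis .
qed

section \<open>The upper bound common to arcsin and arsinh\<close>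

text \<open>
  Both signs of \<open>\<sigma>\<close> matter: \<open>\<sigma> = -1\<close> gives the bound for arcsin and \<open>\<sigma> = 1\<close> the one for arsinh.
\<close>

lemma integral_powr_less_times_powr:
  fixes a q \<sigma> x :: real
  assumes a: "0 < a" "a < 1" and q: "0 < q" and x: "0 < x"
    and \<sigma>: "\<sigma> \<noteq> 0" "0 < 1 + \<sigma> * x powr q"
  shows "integral {0..x} (\<lambda>t. (1 + \<sigma> * t powr q) powr (- a))
    < x * (1 + \<sigma> * x powr q) powr (- a / (1 + q))"
proof (rule integral_less_by_deriv[OF x])
  define b where "b = a / (1 + q)"
  have ab: "a = b + b * q"
    using q by (simp add: b_def divide_simps) (simp add: algebra_simps)
  have b: "0 < b"
    using a q by (simp add: b_def)
  have bq: "0 < b * q" "b * q < 1"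
    using b q a ab by auto
  fix t assume t: "0 < t" "t < x"
  define y where "y = \<sigma> * t powr q"
  have y: "0 < 1 + y" "y \<noteq> 0"
    using one_plus_mult_powr_pos[OF q _ _ \<sigma>(2), of t] t \<sigma>(1) by (auto simp: y_def)
  \<comment> \<open>Splitting off the power that occurs in the derivative leaves the exponent \<open>1 - bq\<close>.\<close>
  have "(1 + y) powr (- a) = (1 + y) powr (- b - 1) * (1 + y) powr (1 - b * q)"
    by (simp add: ab flip: powr_add)
  also have "\<dots> < (1 + y) powr (- b - 1) * (1 + (1 - b * q) * y)"
    using Bernoulli_powr_less[of "1 - b * q" y] bq y by (intro mult_strict_left_mono) auto
  finally have less: "(1 + y) powr (- a) < (1 + y) powr (- b - 1) * (1 + (1 - b * q) * y)" .
  have "- a / (1 + q) = - b"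
    by (simp add: b_def)
  then have "((\<lambda>t. t * (1 + \<sigma> * t powr q) powr (- a / (1 + q))) has_real_derivative
      (1 + y) powr (- b - 1) * (1 + (1 - b * q) * y)) (at t)"
    using has_real_derivative_times_powr[of t \<sigma> q "- b"] t y by (simp add: y_def)
  then show "\<exists>d. ((\<lambda>t. t * (1 + \<sigma> * t powr q) powr (- a / (1 + q))) has_real_derivative d) (at t)
      \<and> (1 + \<sigma> * t powr q) powr (- a) < d"
    using less unfolding y_def by (intro exI conjI)
next
  show "continuous_on {0..x} (\<lambda>t. (1 + \<sigma> * t powr q) powr (- a))"
    by (rule continuous_on_one_plus_mult_powr[OF q \<sigma>(2)])
  show "continuous_on {0..x} (\<lambda>t. t * (1 + \<sigma> * t powr q) powr (- a / (1 + q)))"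
    using continuous_on_one_plus_mult_powr[OF q \<sigma>(2)]
    by (rule continuous_on_mult[OF continuous_on_id])
qed simp

section \<open>Bounds for arcsin\<close>

lemma polynomial_less_arcsin_pq:
  fixes p q x :: real
  assumes p: "p > 1" and q: "q > 0" and x: "0 < x" "x < 1"
  shows "x * (1 + x powr q / (p * (1 + q))) < arcsin_pq p q x"
proof -
  have s1: "0 < 1 + (-1) * x powr q"
    using x q by (simp add: powr01_less_one)
  have "x * (1 + x powr q / (p * (1 + q))) < integral {0..x} (\<lambda>t. (1 + (-1) * t powr q) powr (- 1 / p))"
  proof (rule integral_greater_by_deriv[OF x(1)])
    fix t assume t: "0 < t" "t < x"
    have eq: "(1 + 1 / (p * (1 + q)) * u powr q) powr 1 = 1 + u powr q / (p * (1 + q))" for u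
      using p q by simp
    have pos: "0 < 1 + 1 / (p * (1 + q)) * t powr q"
      using p q by (simp add: add_pos_nonneg)
    then have "(1 + 1 / (p * (1 + q)) * t powr q) powr (1 - 1) = 1"
      by (simp del: times_divide_eq_left)
    then have "((\<lambda>t. t * (1 + t powr q / (p * (1 + q)))) has_real_derivative
        1 + (1 + q) * (1 / (p * (1 + q)) * t powr q)) (at t)"
      using has_real_derivative_times_powr[OF t(1) pos, of 1] unfolding eq by (simp only: mult_1)
    moreover have "1 + (1 + q) * (1 / (p * (1 + q)) * t powr q) = 1 - 1 / p * (- (t powr q))"
      using p q by (simp add: divide_simps)
    ultimately have D: "((\<lambda>t. t * (1 + t powr q / (p * (1 + q)))) has_real_derivative
        1 - 1 / p * (- (t powr q))) (at t)"
      by simp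
    have "1 - 1 / p * (- (t powr q)) < (1 + - (t powr q)) powr (- (1 / p))"
      using p t x q by (intro Bernoulli_powr_minus_greater) (auto simp: powr01_less_one)
    with D show "\<exists>d. ((\<lambda>t. t * (1 + t powr q / (p * (1 + q)))) has_real_derivative d) (at t)
        \<and> d < (1 + (-1) * t powr q) powr (- 1 / p)"
      by auto
  next
    show "continuous_on {0..x} (\<lambda>t. t * (1 + t powr q / (p * (1 + q))))"
      using p q by (intro continuous_intros continuous_on_powr') auto
    show "continuous_on {0..x} (\<lambda>t. (1 + (-1) * t powr q) powr (- 1 / p))"
      using continuous_on_one_plus_mult_powr[OF q s1] .
  qed simp
  then show ?thesis
    by (simp add: arcsin_pq_def)
qed

text \<open>
  The singularity at 1 is no worse than that of \<open>(1 - t)\<^bsup>-1/p\<^esup>\<close>, because \<open>t\<^sup>q \<le> t\<close>; this is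
  integrable since \<open>1/p < 1\<close>.
\<close>

lemma arcsin_pq_integrand_integrable:
  fixes p q :: real
  assumes p: "p > 1" and q: "q \<ge> 1"
  shows "(\<lambda>t. (1 - t powr q) powr (- 1 / p)) integrable_on {0..1}"
proof (rule measurable_bounded_by_integrable_imp_integrable_real)
  show "(\<lambda>t. (1 - t powr q) powr (- 1 / p)) \<in> borel_measurable (lebesgue_on {0..1})"
    by (intro measurable_restrict_space1 measurable_completion) measurable
  have "(\<lambda>t::real. t powr (- 1 / p)) integrable_on cbox 0 1"
    using p integrable_on_powr_from_0[of "- 1 / p" 1] by (simp add: field_simps)
  from integrable_affinity[OF this, of "-1" 1]
  show "(\<lambda>t. (1 - t) powr (- 1 / p)) integrable_on {0..1::real}"
    by simp
next
  fix t :: real assume t: "t \<in> {0..1}"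
  show "\<bar>(1 - t powr q) powr (- 1 / p)\<bar> \<le> (1 - t) powr (- 1 / p)"
  proof (cases "t = 1")
    case False
    have "t powr q \<le> t powr 1" if "t > 0"
      using t q that by (intro powr_mono') auto
    then have "t powr q \<le> t"
      using t by (cases "t = 0") auto
    then show ?thesis
      using t False p by (auto intro!: powr_mono2')
  qed simp
qed auto

text \<open>
  The integrand \<open>f\<close> increases, so the mean of \<open>f\<close> over \<open>[0, x]\<close> is less than \<open>f x\<close>, which is at most
  the mean over \<open>[x, 1]\<close>. Strictness is needed on one side only, and the bounded part \<open>[0, x]\<close> is
  where derivatives supply it.
\<close>

lemma arcsin_pq_less_chord:
  fixes p q x :: real
  assumes p: "p > 1" and q: "q \<ge> 1" and x: "0 < x" "x < 1"
  shows "arcsin_pq p q x < pi_pq p q / 2 * x"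
proof -
  define f where "f = (\<lambda>t. (1 - t powr q) powr (- 1 / p))"
  have mono: "f t < f u" if "0 \<le> t" "t < u" "u < 1" for t u
  proof -
    have "t powr q < u powr q" "u powr q < 1"
      using that q by (auto simp: powr01_less_one intro!: powr_less_mono2)
    then show ?thesis
      unfolding f_def using p by (intro powr_less_mono2_neg) auto
  qed
  have int: "f integrable_on {0..1}"
    unfolding f_def by (rule arcsin_pq_integrand_integrable[OF p q])
  have left: "integral {0..x} f < x * f x"
  proof (rule integral_less_by_deriv[OF x(1), where G = "\<lambda>t. t * f x"])
    fix t assume "0 < t" "t < x"
    then show "\<exists>d. ((\<lambda>t. t * f x) has_real_derivative d) (at t) \<and> f t < d"
      using mono[of t x] x by (intro exI[of _ "f x"]) (auto intro!: derivative_eq_intros)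
  next
    have "0 < 1 + (-1) * x powr q"
      using x q by (simp add: powr01_less_one)
    from continuous_on_one_plus_mult_powr[OF _ this, of "- 1 / p"] q
    show "continuous_on {0..x} f"
      by (simp add: f_def)
  qed (auto intro!: continuous_intros)
  \<comment> \<open>The endpoint 1 is left out because \<open>f 1 = 0 powr (- 1 / p) = 0\<close>.\<close>
  have "integral {x<..<1} (\<lambda>t. f x) \<le> integral {x<..<1} f"
  proof (rule integral_le)
    show "f integrable_on {x<..<1}"
      using integrable_on_subinterval[OF int, of x 1] x
      by (simp add: integrable_on_open_interval_real)
    show "(\<lambda>t. f x) integrable_on {x<..<1}"
      by (simp add: integrable_on_open_interval_real integrable_const_ivl)
    show "f x \<le> f t" if "t \<in> {x<..<1}" for t
      using mono[of x t] that x by simp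
  qed
  then have "integral {x..1} (\<lambda>t. f x) \<le> integral {x..1} f"
    by (simp only: integral_open_interval_real)
  then have right: "(1 - x) * f x \<le> integral {x..1} f"
    using x by simp
  have split: "integral {0..x} f + integral {x..1} f = integral {0..1} f"
    using x int by (intro Henstock_Kurzweil_Integration.integral_combine[where c = x]) auto
  have "(1 - x) * integral {0..x} f < (1 - x) * (x * f x)"
    using left x by (intro mult_strict_left_mono) auto
  also have "\<dots> \<le> x * integral {x..1} f"
    using mult_left_mono[OF right, of x] x by (simp add: mult_ac)
  finally have "integral {0..x} f < x * (integral {0..x} f + integral {x..1} f)"
    by (simp add: algebra_simps)
  then show ?thesis
    unfolding split by (simp add: f_def arcsin_pq_def pi_pq_def mult.commute)
qed

section \<open>Bounds for arsinh\<close>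

text \<open>
  The derivative of the left-hand side is the pure power \<open>(1 + cs)\<^bsup>-1/q-1\<^esup>\<close>, and the integrand is
  \<open>((1 + s)\<^bsup>c\<^esup>)\<^bsup>-1/q-1\<^esup>\<close>, so the bases can be compared.
\<close>

lemma times_powr_less_integral_powr:
  fixes a q x :: real
  assumes a: "0 < a" "a < 1" and q: "0 < q" and x: "0 < x"
  shows "x * (1 + a * q / (1 + q) * x powr q) powr (- 1 / q)
    < integral {0..x} (\<lambda>t. (1 + t powr q) powr (- a))"
proof (rule integral_greater_by_deriv[OF x])
  define c where "c = a * q / (1 + q)"
  have aq: "a * q < 1 + q"
    using mult_strict_right_mono[OF a(2) q] by linarith
  have c: "0 < c" "c < 1"
    using a q aq by (auto simp: c_def divide_less_eq)
  have ca: "c * (- 1 / q - 1) = - a"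
    using q by (simp add: c_def divide_simps) (simp add: algebra_simps)
  fix t assume t: "0 < t" "t < x"
  define s where "s = t powr q"
  have s: "s > 0"
    using t by (simp add: s_def)
  have "(1 + c * s) powr (- 1 / q - 1) < ((1 + s) powr c) powr (- 1 / q - 1)"
    using q s c Bernoulli_powr_less[of c s]
    by (intro powr_less_mono2_neg) (auto simp: diff_less_eq add_pos_pos field_simps)
  also have "\<dots> = (1 + s) powr (- a)"
    by (simp only: powr_powr ca)
  finally have "(1 + c * s) powr (- 1 / q - 1) < (1 + s) powr (- a)" .
  moreover have "((\<lambda>t. t * (1 + c * t powr q) powr (- 1 / q)) has_real_derivative
      (1 + c * s) powr (- 1 / q - 1)) (at t)"
    using has_real_derivative_times_powr[of t c q "- 1 / q"] t q c s
    by (simp add: s_def add_pos_pos)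
  ultimately show "\<exists>d. ((\<lambda>t. t * (1 + a * q / (1 + q) * t powr q) powr (- 1 / q))
      has_real_derivative d) (at t) \<and> d < (1 + t powr q) powr (- a)"
    by (auto simp: s_def c_def)
next
  show "continuous_on {0..x} (\<lambda>t. (1 + t powr q) powr (- a))"
    using continuous_on_one_plus_mult_powr[of q 1 x "- a"] q by (simp add: add_pos_nonneg)
  show "continuous_on {0..x} (\<lambda>t. t * (1 + a * q / (1 + q) * t powr q) powr (- 1 / q))"
    using a q
    by (intro continuous_on_mult continuous_on_id continuous_on_one_plus_mult_powr add_pos_nonneg) auto
qed auto

text \<open>
  The derivative of the left-hand side is \<open>(1 + s)\<^bsup>-a\<^esup>\<close> times a rational function
  \<open>N / (1 + ks)\<^sup>2\<close> of \<open>s\<close>, and that function is less than 1.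
\<close>

lemma times_powr_divide_less_integral_powr:
  fixes a q x :: real
  assumes a: "0 < a" "a < 1" and q: "0 < q" and x: "0 < x"
  shows "x * (1 + x powr q) powr (1 - a) / (1 + (1 - a * q / (1 + q)) * x powr q)
    < integral {0..x} (\<lambda>t. (1 + t powr q) powr (- a))"
proof (rule integral_greater_by_deriv[OF x])
  define c where "c = a * q / (1 + q)"
  define k where "k = 1 - c"
  have aq: "a * q < 1 + q"
    using mult_strict_right_mono[OF a(2) q] by linarith
  have c: "0 < c" "c < 1"
    using a q aq by (auto simp: c_def divide_less_eq)
  then have k: "0 < k"
    by (simp add: k_def)
  have ca: "a * q = c + c * q"
    using q by (simp add: c_def divide_simps) (simp add: algebra_simps)
  show "\<exists>d. ((\<lambda>t. t * (1 + t powr q) powr (1 - a) / (1 + (1 - a * q / (1 + q)) * t powr q))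
      has_real_derivative d) (at t) \<and> d < (1 + t powr q) powr (- a)"
    if t: "0 < t" "t < x" for t
  proof -
    define s where "s = t powr q"
    have s: "s > 0"
      using t by (simp add: s_def)
    have D1: "((\<lambda>t. t * (1 + t powr q) powr (1 - a)) has_real_derivative
        (1 + s) powr (- a) * (1 + (1 + (1 - a) * q) * s)) (at t)"
      using has_real_derivative_times_powr[of t 1 q "1 - a"] t s
      by (simp add: s_def add_pos_pos)
    have D2: "((\<lambda>t. 1 + k * t powr q) has_real_derivative k * (q * t powr (q - 1))) (at t)"
      using t by (auto intro!: derivative_eq_intros has_real_derivative_powr)
    define N where "N = (1 + (1 + (1 - a) * q) * s) * (1 + k * s) - (1 + s) * (k * q * s)"
    have ks: "0 < 1 + k * s"
      using k s by (simp add: add_pos_pos)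
    have "((\<lambda>t. t * (1 + t powr q) powr (1 - a) / (1 + k * t powr q)) has_real_derivative
        ((1 + s) powr (- a) * (1 + (1 + (1 - a) * q) * s) * (1 + k * s)
          - t * (1 + s) powr (1 - a) * (k * (q * t powr (q - 1)))) / ((1 + k * s) * (1 + k * s))) (at t)"
      using DERIV_divide[OF D1 D2] ks by (simp add: s_def)
    also have "t * (1 + s) powr (1 - a) * (k * (q * t powr (q - 1))) = (1 + s) powr (- a) * ((1 + s) * (k * q * s))"
      using t s by (simp add: s_def powr_diff powr_minus divide_simps)
    also have "((1 + s) powr (- a) * (1 + (1 + (1 - a) * q) * s) * (1 + k * s)
          - (1 + s) powr (- a) * ((1 + s) * (k * q * s))) / ((1 + k * s) * (1 + k * s))
        = (1 + s) powr (- a) * (N / (1 + k * s)\<^sup>2)"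
      by (simp add: N_def power2_eq_square algebra_simps)
    finally have D: "((\<lambda>t. t * (1 + t powr q) powr (1 - a) / (1 + k * t powr q)) has_real_derivative
        (1 + s) powr (- a) * (N / (1 + k * s)\<^sup>2)) (at t)" .
    \<comment> \<open>The value of \<open>c\<close> is the one for which the first term vanishes.\<close>
    have "N - (1 + k * s)\<^sup>2 = (c + c * q - a * q) * (s + k * s\<^sup>2) - c * q * k * s\<^sup>2"
      by (simp add: N_def k_def power2_eq_square algebra_simps)
    also have "\<dots> = - (c * q * k * s\<^sup>2)"
      by (simp add: ca)
    also have "\<dots> < 0"
      using c q k s by simp
    finally have "N < (1 + k * s)\<^sup>2"
      by simp
    then have "N / (1 + k * s)\<^sup>2 < 1"
      using ks by simp
    then have "(1 + s) powr (- a) * (N / (1 + k * s)\<^sup>2) < (1 + s) powr (- a) * 1"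
      using s by (intro mult_strict_left_mono) auto
    with D show ?thesis
      by (auto simp: s_def k_def c_def)
  qed
  have "1 + k * t powr q \<noteq> 0" for t
    using k by (metis add_pos_nonneg less_irrefl mult_nonneg_nonneg less_imp_le powr_ge_zero zero_less_one)
  moreover have cont: "continuous_on {0..x} (\<lambda>t. (1 + t powr q) powr e)" for e
    using continuous_on_one_plus_mult_powr[of q 1 x e] q by (simp add: add_pos_nonneg)
  moreover have "continuous_on {0..x} (\<lambda>t. 1 + k * t powr q)"
    using q by (intro continuous_intros continuous_on_powr') auto
  ultimately have "continuous_on {0..x} (\<lambda>t. t * (1 + t powr q) powr (1 - a) / (1 + k * t powr q))"
    by (intro continuous_on_divide continuous_on_mult continuous_on_id) auto
  then show "continuous_on {0..x}
      (\<lambda>t. t * (1 + t powr q) powr (1 - a) / (1 + (1 - a * q / (1 + q)) * t powr q))"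
    by (simp only: k_def c_def)
  show "continuous_on {0..x} (\<lambda>t. (1 + t powr q) powr (- a))"
    by (rule cont)
qed auto

lemma arsinh_pq_prefactor:
  fixes p q x :: real
  assumes "p > 0" "x > 0"
  shows "(x powr p / (1 + x powr q)) powr (1 / p) = x * (1 + x powr q) powr (- 1 / p)"
  using assms by (simp add: powr_divide powr_powr powr_minus_divide)

lemma arsinh_pq_lower_1:
  fixes p q x :: real
  assumes p: "p > 1" and q: "q > 0" and x: "0 < x"
  shows "(x powr p / (1 + x powr q)) powr (1 / p)
      * inverse (1 - (q * x powr q) / (p * (1 + q) * (1 + x powr q))) < arsinh_pq p q x"
proof -
  define s where "s = x powr q"
  have s: "s > 0"
    using x by (simp add: s_def)
  have "1 - (q * s) / (p * (1 + q) * (1 + s)) = (1 + (1 - 1 / p * q / (1 + q)) * s) / (1 + s)"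
    using p q s by (simp add: divide_simps add_pos_pos) (simp add: algebra_simps)
  moreover have "(1 + s) powr (1 - 1 / p) = (1 + s) * (1 + s) powr (- 1 / p)"
    using s by (simp add: powr_diff powr_minus_divide)
  ultimately show ?thesis
    using times_powr_divide_less_integral_powr[of "1 / p" q x] p q x
    by (simp add: arsinh_pq_prefactor arsinh_pq_def s_def inverse_eq_divide mult_ac)
qed

lemma arsinh_pq_lower_2:
  fixes p q x :: real
  assumes p: "p > 1" and q: "q > 0" and x: "0 < x"
  shows "(x powr p / (1 + x powr q)) powr (1 / p)
      * ((x powr q + 1) powr (1 / p) * ((p * q + p + q * x powr q) / (p * (q + 1))) powr (- 1 / q))
      < arsinh_pq p q x"
proof -
  have "(p * q + p + q * x powr q) / (p * (q + 1)) = 1 + 1 / p * q / (1 + q) * x powr q"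
    using p q by (simp add: divide_simps add_pos_pos) (simp add: algebra_simps)
  moreover have "(1 + x powr q) powr (- 1 / p) * (x powr q + 1) powr (1 / p) = 1"
    by (simp add: powr_minus_divide add.commute add_nonneg_eq_0_iff)
  ultimately show ?thesis
    using times_powr_less_integral_powr[of "1 / p" q x] p q x
    by (simp add: arsinh_pq_prefactor arsinh_pq_def mult.assoc)
       (metis (no_types, lifting) mult.assoc mult_1)
qed

lemma arsinh_pq_less_upper:
  fixes p q x :: real
  assumes p: "p > 1" and q: "q > 0" and x: "0 < x"
  shows "arsinh_pq p q x < (x powr p / (1 + x powr q)) powr (1 / p) * U_pq p q x"
proof -
  define s where "s = x powr q"
  have s: "s > 0"
    using x by (simp add: s_def)
  have "1 - s / (1 + s) = (1 + s) powr (- 1)"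
    using s by (simp add: powr_minus_divide field_simps)
  then have "U_pq p q x = (1 + s) powr (q / (p * (q + 1)))"
    by (simp only: U_pq_def s_def[symmetric] powr_powr) simp
  then have "(1 + s) powr (- 1 / p) * U_pq p q x = (1 + s) powr (- 1 / p + q / (p * (q + 1)))"
    by (simp only: powr_add)
  also have "- 1 / p + q / (p * (q + 1)) = - (1 / p) / (1 + q)"
    using p q by (simp add: divide_simps)
  finally show ?thesis
    using integral_powr_less_times_powr[of "1 / p" q x 1] p q x add_pos_pos[OF zero_less_one s]
    by (simp add: arsinh_pq_prefactor arsinh_pq_def s_def mult.assoc)
qed

section \<open>The inequalities for arcsin and arsinh\<close>

theorem theorem1p1:
  fixes p q x :: real
  assumes "p > 1" and "q > 1" and "0 < x" and "x < 1"
  shows "(x * (1 + x powr q / (p * (1 + q))) < arcsin_pq p q x \<and>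
          arcsin_pq p q x < min (pi_pq p q / 2 * x)
                                ((1 - x powr q) powr (- 1 / (p * (1 + q))) * x)) \<and>
         ((x powr p / (1 + x powr q)) powr (1 / p) * L_pq p q x < arsinh_pq p q x \<and>
          arsinh_pq p q x < (x powr p / (1 + x powr q)) powr (1 / p) * U_pq p q x)"
proof (intro conjI)
  show "x * (1 + x powr q / (p * (1 + q))) < arcsin_pq p q x"
    using assms by (intro polynomial_less_arcsin_pq) auto
next
  have "0 < 1 + (-1) * x powr q"
    using assms by (simp add: powr01_less_one)
  then have "arcsin_pq p q x < (1 - x powr q) powr (- 1 / (p * (1 + q))) * x"
    using integral_powr_less_times_powr[of "1 / p" q x "-1"] assms
    by (simp add: arcsin_pq_def mult.commute)
  then show "arcsin_pq p q x < min (pi_pq p q / 2 * x) ((1 - x powr q) powr (- 1 / (p * (1 + q))) * x)"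
    using arcsin_pq_less_chord[of p q x] assms by simp
next
  show "(x powr p / (1 + x powr q)) powr (1 / p) * L_pq p q x < arsinh_pq p q x"
    using arsinh_pq_lower_1[of p q x] arsinh_pq_lower_2[of p q x] assms
    by (simp add: L_pq_def max_def)
next
  show "arsinh_pq p q x < (x powr p / (1 + x powr q)) powr (1 / p) * U_pq p q x"
    using assms by (intro arsinh_pq_less_upper) auto
qed

end
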